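(* Let $G$ be a closed subgroup of $S_\infty$ and suppose $G$ acts continuously on the Polish space $X$. Then the following are equivalent for any $x\in X$: (i) the orbit $G\cdot x$ is dense $G_\delta$; (ii) $G\cdot x$ is dense and turbulent.
   Context: $S_\infty$ is the Polish group of all permutations of $\mathbb N$ with the pointwise convergence topology. Let a Polish group $G$ act continuously on a Polish space $X$. For $x\in X$, an open neighborhood $U$ of $x$ and an open symmetric neighborhood $V$ of the identity of $G$, the $(U,V)$-local orbit $\mathcal O(x,U,V)$ is the set of all $y\in U$ for which there is a finite sequence $g_0,\dots,g_k\in V$ such that, with $x_0=x$ and $x_{i+1}=g_i\cdot x_i$, one has $x_{k+1}=y$ and $x_i\in U$ for all $i$. A point $x$ is turbulent if $\mathrm{Int}(\overline{\mathcal O(x,U,V)})\neq\emptyset$ for all such $U,V$. This property depends only on the orbit of $x$, and an orbit is called turbulent if its points are turbulent. *)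

theory Defs
  imports "HOL-Analysis.Analysis" "HOL-Algebra.Group_Action"
begin

definition Polish_space :: "'a topology \<Rightarrow> bool" where
  "Polish_space X \<longleftrightarrow> completely_metrizable_space X \<and> separable_space X"

abbreviation S_infty :: "(nat \<Rightarrow> nat) monoid" where
  "S_infty \<equiv> BijGroup UNIV"

definition S_infty_top :: "(nat \<Rightarrow> nat) topology" where
  "S_infty_top =
     subtopology (product_topology (\<lambda>_. discrete_topology UNIV) UNIV) (carrier S_infty)"

lemma S_infty_carrier: "carrier S_infty = {f. bij f}"
  by (simp add: BijGroup_def Bij_def)

lemma S_infty_mult:
  "f \<in> carrier S_infty \<Longrightarrow> g \<in> carrier S_infty \<Longrightarrow> f \<otimes>\<^bsub>S_infty\<^esub> g = f \<circ> g"
  by (simp add: BijGroup_def compose_def fun_eq_iff)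

lemma topspace_S_infty_top: "topspace S_infty_top = carrier S_infty"
  by (simp add: S_infty_top_def)

definition continuous_action ::
    "('g, 'm) monoid_scheme \<Rightarrow> 'g topology \<Rightarrow> 'a topology \<Rightarrow> ('g \<Rightarrow> 'a \<Rightarrow> 'a) \<Rightarrow> bool" where
  "continuous_action G T X \<phi> \<longleftrightarrow>
     group_action G (topspace X) \<phi> \<and>
     continuous_map (prod_topology T X) X (\<lambda>(g, y). \<phi> g y)"

text \<open>The points \<open>s 0, \<dots>, s (k + 1)\<close> are the successive points of a path
  driven by the group elements \<open>g 0, \<dots>, g k\<close>; values of \<open>s\<close> and \<open>g\<close> beyond
  these indices are irrelevant.\<close>

definition local_orbit ::
    "('g \<Rightarrow> 'a \<Rightarrow> 'a) \<Rightarrow> 'a \<Rightarrow> 'a set \<Rightarrow> 'g set \<Rightarrow> 'a set" where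
  "local_orbit \<phi> x U V =
     {y \<in> U. \<exists>(k::nat) (g :: nat \<Rightarrow> 'g) (s :: nat \<Rightarrow> 'a).
        (\<forall>i\<le>k. g i \<in> V) \<and>
        s 0 = x \<and> (\<forall>i\<le>k. s (Suc i) = \<phi> (g i) (s i)) \<and> s (Suc k) = y \<and>
        (\<forall>i\<le>Suc k. s i \<in> U)}"

definition symmetric_nbhd_one ::
    "('g, 'm) monoid_scheme \<Rightarrow> 'g topology \<Rightarrow> 'g set \<Rightarrow> bool" where
  "symmetric_nbhd_one G T V \<longleftrightarrow>
     openin T V \<and> \<one>\<^bsub>G\<^esub> \<in> V \<and> (\<forall>g\<in>V. inv\<^bsub>G\<^esub> g \<in> V)"

definition turbulent_point ::
    "('g, 'm) monoid_scheme \<Rightarrow> 'g topology \<Rightarrow> 'a topology \<Rightarrow> ('g \<Rightarrow> 'a \<Rightarrow> 'a) \<Rightarrow> 'a \<Rightarrow> bool" where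
  "turbulent_point G T X \<phi> x \<longleftrightarrow>
     (\<forall>U V. openin X U \<and> x \<in> U \<and> symmetric_nbhd_one G T V \<longrightarrow>
        X interior_of (X closure_of (local_orbit \<phi> x U V)) \<noteq> {})"

definition turbulent_orbit ::
    "('g, 'm) monoid_scheme \<Rightarrow> 'g topology \<Rightarrow> 'a topology \<Rightarrow> ('g \<Rightarrow> 'a \<Rightarrow> 'a) \<Rightarrow> 'a set \<Rightarrow> bool" where
  "turbulent_orbit G T X \<phi> A \<longleftrightarrow> (\<forall>y\<in>A. turbulent_point G T X \<phi> y)"

definition dense_in :: "'a topology \<Rightarrow> 'a set \<Rightarrow> bool" where
  "dense_in X A \<longleftrightarrow> A \<subseteq> topspace X \<and> X closure_of A = topspace X"

end

theory Submission
  imports Defs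
begin

text \<open>
  The identity of a permutation group \<open>G\<close> has a neighbourhood base of open subgroups
  \<open>V n\<close>, the elements that fix \<open>0, \<dots>, n - 1\<close>. Because these are subgroups, a path driven by
  \<open>V n\<close> never leaves the set \<open>V n \<cdot> x\<close>, so turbulence of \<open>x\<close> loses its combinatorics: it says
  that, for every \<open>n\<close>, the point \<open>x\<close> is interior to the closure of \<open>V n \<cdot> x\<close>
  (\<open>turbulent_point_iff\<close>). Call this property of \<open>x\<close> local density; it is invariant under \<open>G\<close>.

  A dense G-delta orbit is comeager, and it is the union of countably many translates of
  \<open>V n \<cdot> x\<close>, because \<open>V n\<close> has countable index. By the Baire category theorem one of the
  translates is somewhere dense, hence so is \<open>V n \<cdot> x\<close> (\<open>dense_gdelta_orbit_locally_dense\<close>).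

  Conversely, let \<open>G \<cdot> x\<close> be dense and \<open>x\<close> locally dense. For fixed \<open>n\<close>, the interiors of the
  closures of the sets \<open>V n \<cdot> y\<close>, with \<open>y \<in> G \<cdot> x\<close>, are pairwise equal or disjoint. It is
  therefore a G-delta condition on \<open>z\<close> that \<open>z\<close> lies in one of these open pieces and that
  \<open>V n \<cdot> z\<close> is dense in that piece. Points of \<open>G \<cdot> x\<close> satisfy it for all \<open>n\<close>. A point \<open>z\<close> that
  satisfies it for all \<open>n\<close> is itself locally dense, and then a back-and-forth construction
  (\<open>same_orbit_back_and_forth\<close>) moves \<open>x\<close> and \<open>z\<close> in turn towards a common limit by group
  elements \<open>a 0, a 2, \<dots>\<close> and \<open>a 1, a 3, \<dots>\<close>. Each new increment fixes so long an initial segment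
  that both sequences converge, within the closed group \<open>G\<close>, to some \<open>g\<close> and \<open>h\<close> with
  \<open>g \<cdot> x = h \<cdot> z\<close>. So the G-delta condition defines \<open>G \<cdot> x\<close> (\<open>locally_dense_orbit_gdelta\<close>).
\<close>

section \<open>Metric preliminaries\<close>

lemma separable_metrizable_imp_second_countable:
  assumes "metrizable_space X" "separable_space X"
  shows "second_countable X"
proof -
  obtain M d where md: "Metric_space M d" and X: "X = Metric_space.mtopology M d"
    using assms(1) by (auto simp: metrizable_space_def)
  interpret Metric_space M d by (fact md)
  obtain C where C: "countable C" "C \<subseteq> M" "mtopology closure_of C = M"
    using assms(2) by (auto simp: separable_space_def X)
  define \<B> where "\<B> = (\<lambda>(c, n). mball c (inverse (Suc n))) ` (C \<times> (UNIV :: nat set))"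
  have "\<exists>V\<in>\<B>. y \<in> V \<and> V \<subseteq> U" if U: "openin mtopology U" "y \<in> U" for U y
  proof -
    obtain r where r: "r > 0" "mball y r \<subseteq> U" and y: "y \<in> M"
      using U openin_mtopology by blast
    obtain n where n: "inverse (Suc n) < r / 2"
      using r reals_Archimedean[of "r/2"] by auto
    have "y \<in> mtopology closure_of C" using C y by simp
    moreover have "inverse (real (Suc n)) > 0" by simp
    ultimately obtain c where c: "c \<in> C" "c \<in> mball y (inverse (Suc n))"
      unfolding metric_closure_of by blast
    have "mball c (inverse (Suc n)) \<subseteq> mball y r"
    proof
      fix w assume "w \<in> mball c (inverse (Suc n))"
      moreover have "d y w \<le> d y c + d c w" if "w \<in> M"
        using triangle y c that by auto
      ultimately show "w \<in> mball y r" using c n by auto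
    qed
    moreover have "y \<in> mball c (inverse (Suc n))"
      using c commute by auto
    ultimately show ?thesis using r c unfolding \<B>_def by force
  qed
  moreover have "countable \<B>" unfolding \<B>_def using C by auto
  moreover have "openin mtopology V" if "V \<in> \<B>" for V using that by (auto simp: \<B>_def)
  ultimately show ?thesis unfolding second_countable_def X by blast
qed

lemma (in Metric_space) MCauchy_geometric:
  assumes M: "\<And>n. \<sigma> n \<in> M" and step: "\<And>n. d (\<sigma> n) (\<sigma> (Suc n)) \<le> (1/2) ^ n"
  shows "MCauchy \<sigma>"
  unfolding MCauchy_def
proof (intro conjI allI impI)
  show "range \<sigma> \<subseteq> M" using M by auto
next
  have *: "d (\<sigma> n) (\<sigma> (n + k)) \<le> 2 * (1/2) ^ n - 2 * (1/2) ^ (n + k)" for n k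
  proof (induction k)
    case 0
    show ?case using M by simp
  next
    case (Suc k)
    have "d (\<sigma> n) (\<sigma> (n + Suc k)) \<le> d (\<sigma> n) (\<sigma> (n + k)) + d (\<sigma> (n + k)) (\<sigma> (Suc (n + k)))"
      using triangle[OF M M M] by simp
    also have "\<dots> \<le> 2 * (1/2) ^ n - 2 * (1/2) ^ (n + k) + (1/2) ^ (n + k)"
      using Suc step[of "n + k"] by linarith
    finally show ?case by simp
  qed
  fix \<epsilon> :: real assume "\<epsilon> > 0"
  then obtain N where N: "(1/2::real) ^ N < \<epsilon> / 4"
    using real_arch_pow_inv[of "\<epsilon>/4" "1/2"] by auto
  have near: "d (\<sigma> N) (\<sigma> n) \<le> 2 * (1/2) ^ N" if "N \<le> n" for n
  proof -
    have "0 \<le> (1/2::real) ^ n" by simp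
    moreover have "d (\<sigma> N) (\<sigma> n) \<le> 2 * (1/2) ^ N - 2 * (1/2) ^ n"
      using *[of N "n - N"] that by simp
    ultimately show ?thesis by linarith
  qed
  show "\<exists>N. \<forall>n n'. N \<le> n \<longrightarrow> N \<le> n' \<longrightarrow> d (\<sigma> n) (\<sigma> n') < \<epsilon>"
  proof (intro exI allI impI)
    fix n n' assume "N \<le> n" "N \<le> n'"
    have "d (\<sigma> n) (\<sigma> n') \<le> d (\<sigma> N) (\<sigma> n) + d (\<sigma> N) (\<sigma> n')"
      using triangle[of "\<sigma> n" "\<sigma> N" "\<sigma> n'"] M commute[of "\<sigma> n" "\<sigma> N"] by simp
    also have "\<dots> < \<epsilon>" using near[OF \<open>N \<le> n\<close>] near[OF \<open>N \<le> n'\<close>] N by linarith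
    finally show "d (\<sigma> n) (\<sigma> n') < \<epsilon>" .
  qed
qed

lemma finite_initial_segment_bound: "\<exists>m::nat. \<forall>i<n::nat. f i < m"
proof -
  have "finite (f ` {..<n})" by simp
  then show ?thesis unfolding finite_nat_set_iff_bounded by auto
qed

section \<open>Continuous actions of permutation groups\<close>

locale permutation_group_action =
  fixes G :: "(nat \<Rightarrow> nat) set" and X :: "'a topology"
    and \<phi> :: "(nat \<Rightarrow> nat) \<Rightarrow> 'a \<Rightarrow> 'a"
  assumes subgroup_G: "subgroup G S_infty"
    and continuous_action:
      "continuous_action (S_infty\<lparr>carrier := G\<rparr>) (subtopology S_infty_top G) X \<phi>"
begin

abbreviation "\<G> \<equiv> S_infty\<lparr>carrier := G\<rparr>"
abbreviation "T \<equiv> subtopology S_infty_top G"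

sublocale group_action \<G> "topspace X" \<phi>
  using continuous_action by (simp add: continuous_action_def)

lemma bij_G: "g \<in> G \<Longrightarrow> bij g"
  using subgroup.subset[OF subgroup_G] S_infty_carrier by blast

lemma G_subset: "G \<subseteq> carrier S_infty"
  using subgroup.subset[OF subgroup_G] .

lemma one_S_infty: "\<one>\<^bsub>S_infty\<^esub> = id"
  by (simp add: BijGroup_def fun_eq_iff)

lemma id_G: "id \<in> G"
  using subgroup.one_closed[OF subgroup_G] by (simp add: one_S_infty)

lemma comp_G: "g \<in> G \<Longrightarrow> h \<in> G \<Longrightarrow> g \<circ> h \<in> G"
  using subgroup.m_closed[OF subgroup_G] S_infty_mult G_subset by (metis subsetD)

lemma m_inv_S_infty: "g \<in> G \<Longrightarrow> inv\<^bsub>S_infty\<^esub> g = inv_into UNIV g"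
  using inv_BijGroup[of g UNIV] bij_G by (simp add: Bij_def fun_eq_iff)

lemma inv_G: "g \<in> G \<Longrightarrow> inv_into UNIV g \<in> G"
  using subgroup.m_inv_closed[OF subgroup_G] m_inv_S_infty by metis

lemma m_inv_\<G>: "g \<in> G \<Longrightarrow> inv\<^bsub>\<G>\<^esub> g = inv_into UNIV g"
  using group.m_inv_consistent[OF group_BijGroup subgroup_G] m_inv_S_infty by metis

lemma act_comp: "g \<in> G \<Longrightarrow> h \<in> G \<Longrightarrow> y \<in> topspace X \<Longrightarrow> \<phi> (g \<circ> h) y = \<phi> g (\<phi> h y)"
  using composition_rule[of y g h] S_infty_mult[of g h] subsetD[OF G_subset] by simp

lemma act_id: "y \<in> topspace X \<Longrightarrow> \<phi> id y = y"
  using id_eq_one by (auto simp: one_S_infty dest!: fun_cong[where x = y])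

lemma act_closed: "g \<in> G \<Longrightarrow> y \<in> topspace X \<Longrightarrow> \<phi> g y \<in> topspace X"
  using element_image[of g y "\<phi> g y"] by simp

lemma act_inv_act:
  assumes "g \<in> G" "y \<in> topspace X"
  shows "\<phi> (inv_into UNIV g) (\<phi> g y) = y"
proof -
  have "inv_into UNIV g \<circ> g = id" using bij_G[OF assms(1)] by (simp add: bij_is_inj)
  then show ?thesis using act_comp[OF inv_G[OF assms(1)] assms] act_id assms(2) by simp
qed

lemma act_act_inv:
  assumes "g \<in> G" "y \<in> topspace X"
  shows "\<phi> g (\<phi> (inv_into UNIV g) y) = y"
proof -
  have "g \<circ> inv_into UNIV g = id"
    using bij_G[OF assms(1)] by (simp add: bij_is_surj surj_iff[symmetric])
  then show ?thesis using act_comp[OF assms(1) inv_G[OF assms(1)] assms(2)] act_id assms(2) by simp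
qed

lemma topspace_T: "topspace T = G"
  using G_subset by (auto simp: topspace_S_infty_top)

lemma continuous_map_action: "continuous_map (prod_topology T X) X (\<lambda>(g, y). \<phi> g y)"
  using continuous_action by (simp add: continuous_action_def)

lemma continuous_map_act:
  assumes "g \<in> G"
  shows "continuous_map X X (\<phi> g)"
proof -
  have "continuous_map X (prod_topology T X) (\<lambda>y. (g, y))"
    using assms topspace_T by (auto simp: continuous_map_pairwise o_def)
  from continuous_map_compose[OF this continuous_map_action] show ?thesis
    by (simp add: o_def)
qed

lemma homeomorphic_map_act:
  assumes "g \<in> G"
  shows "homeomorphic_map X X (\<phi> g)"
  unfolding homeomorphic_map_maps homeomorphic_maps_def
  using continuous_map_act[OF assms] continuous_map_act[OF inv_G[OF assms]]
    act_inv_act[OF assms] act_act_inv[OF assms] by blast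

section \<open>Orbits of the basic open subgroups\<close>

text \<open>These open subgroups form a neighbourhood base at the identity of \<open>G\<close>.\<close>

definition fixing :: "nat \<Rightarrow> (nat \<Rightarrow> nat) set" where
  "fixing n = {g \<in> G. \<forall>i<n. g i = i}"

definition small_orbit :: "nat \<Rightarrow> 'a \<Rightarrow> 'a set" where
  "small_orbit n y = (\<lambda>g. \<phi> g y) ` fixing n"

text \<open>The largest open set in which \<open>small_orbit n y\<close> is dense. It may be empty, but it contains \<open>y\<close> as
  soon as it is not (\<open>self_orbit_core\<close> below).\<close>

definition orbit_core :: "nat \<Rightarrow> 'a \<Rightarrow> 'a set" where
  "orbit_core n y = X interior_of (X closure_of small_orbit n y)"

definition locally_dense_orbits :: "'a \<Rightarrow> bool" where
  "locally_dense_orbits y \<longleftrightarrow> (\<forall>n. y \<in> orbit_core n y)"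

lemma fixing_G: "g \<in> fixing n \<Longrightarrow> g \<in> G"
  by (simp add: fixing_def)

lemma id_fixing: "id \<in> fixing n"
  by (simp add: fixing_def id_G)

lemma comp_fixing: "g \<in> fixing n \<Longrightarrow> h \<in> fixing n \<Longrightarrow> g \<circ> h \<in> fixing n"
  by (simp add: fixing_def comp_G)

lemma inv_fixing: "g \<in> fixing n \<Longrightarrow> inv_into UNIV g \<in> fixing n"
  by (auto simp: fixing_def inv_G inv_f_eq bij_is_inj bij_G)

lemma fixing_0: "fixing 0 = G"
  by (simp add: fixing_def)

lemma small_orbit_0: "small_orbit 0 y = orbit \<G> \<phi> y"
  by (auto simp: small_orbit_def fixing_0 orbit_def)

lemma openin_fixing: "openin T (fixing n)"
proof -
  let ?P = "product_topology (\<lambda>_::nat. discrete_topology (UNIV :: nat set)) UNIV"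
  have "openin ?P {f. \<forall>i<n. f i = i}"
    unfolding openin_product_topology_alt
  proof (intro ballI exI conjI)
    fix f :: "nat \<Rightarrow> nat" assume f: "f \<in> {f. \<forall>i<n. f i = i}"
    let ?U = "\<lambda>i. if i < n then {i} else UNIV"
    have "{i \<in> UNIV. ?U i \<noteq> topspace (discrete_topology (UNIV :: nat set))} \<subseteq> {..<n}"
      by auto
    then show "finite {i \<in> UNIV. ?U i \<noteq> topspace (discrete_topology (UNIV :: nat set))}"
      using finite_subset by blast
    show "f \<in> Pi\<^sub>E UNIV ?U" "Pi\<^sub>E UNIV ?U \<subseteq> {f. \<forall>i<n. f i = i}"
      using f by (auto simp: PiE_def Pi_def split: if_splits)
  qed auto
  moreover have "fixing n = {f. \<forall>i<n. f i = i} \<inter> carrier S_infty \<inter> G"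
    using G_subset by (auto simp: fixing_def)
  ultimately show ?thesis
    unfolding S_infty_top_def openin_subtopology by blast
qed

lemma fixing_neighbourhood_base:
  assumes V: "openin T V" and "id \<in> V"
  obtains n where "fixing n \<subseteq> V"
proof -
  let ?P = "product_topology (\<lambda>_::nat. discrete_topology (UNIV :: nat set)) UNIV"
  obtain W where W: "openin ?P W" and VW: "V = W \<inter> carrier S_infty \<inter> G"
    using V unfolding S_infty_top_def openin_subtopology by auto
  have "id \<in> W" using VW \<open>id \<in> V\<close> by simp
  then obtain U where U: "finite {i. U i \<noteq> (UNIV :: nat set)}" "id \<in> Pi\<^sub>E UNIV U" "Pi\<^sub>E UNIV U \<subseteq> W"
    using W unfolding openin_product_topology_alt by fastforce
  obtain n where n: "\<And>i. U i \<noteq> UNIV \<Longrightarrow> i < n"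
    using U(1) unfolding finite_nat_set_iff_bounded by auto
  have "fixing n \<subseteq> W"
  proof
    fix g assume g: "g \<in> fixing n"
    have "g i \<in> U i" for i
    proof (cases "U i = UNIV")
      case False
      then have "g i = i" using n g by (simp add: fixing_def)
      then show ?thesis using U(2) by (auto simp: PiE_def Pi_def)
    qed simp
    then show "g \<in> W" using U(3) by (auto simp: PiE_def Pi_def)
  qed
  then show thesis using that[of n] VW G_subset by (auto simp: fixing_def)
qed

lemma symmetric_nbhd_fixing: "symmetric_nbhd_one \<G> T (fixing n)"
  unfolding symmetric_nbhd_one_def
  using openin_fixing id_fixing inv_fixing m_inv_\<G> fixing_G by (auto simp: one_S_infty)

lemma small_orbit_topspace: "y \<in> topspace X \<Longrightarrow> small_orbit n y \<subseteq> topspace X"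
  using act_closed fixing_G by (auto simp: small_orbit_def)

lemma self_small_orbit: "y \<in> topspace X \<Longrightarrow> y \<in> small_orbit n y"
  unfolding small_orbit_def by (metis act_id id_fixing image_eqI)

lemma act_small_orbit:
  assumes v: "v \<in> fixing n" and y: "y \<in> topspace X"
  shows "\<phi> v ` small_orbit n y = small_orbit n y"
proof -
  have sub: "\<phi> u ` small_orbit n y \<subseteq> small_orbit n y" if "u \<in> fixing n" for u
    unfolding small_orbit_def
    using act_comp[OF fixing_G[OF that] fixing_G y] comp_fixing[OF that]
    by (force simp: image_iff)
  have "z \<in> \<phi> v ` small_orbit n y" if "z \<in> small_orbit n y" for z
  proof
    show "z = \<phi> v (\<phi> (inv_into UNIV v) z)"
      using act_act_inv[OF fixing_G[OF v], of z] small_orbit_topspace[OF y, of n] that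
      by (simp add: subset_iff)
    show "\<phi> (inv_into UNIV v) z \<in> small_orbit n y"
      using sub[OF inv_fixing[OF v]] that by auto
  qed
  then show ?thesis using sub[OF v] by auto
qed

lemma openin_orbit_core [simp]: "openin X (orbit_core n y)"
  by (simp add: orbit_core_def)

lemma orbit_core_subset: "orbit_core n y \<subseteq> X closure_of small_orbit n y"
  by (simp add: orbit_core_def interior_of_subset)

lemma act_orbit_core:
  assumes v: "v \<in> fixing n" and y: "y \<in> topspace X"
  shows "\<phi> v ` orbit_core n y = orbit_core n y"
proof -
  have h: "homeomorphic_map X X (\<phi> v)"
    using homeomorphic_map_act fixing_G v by blast
  show ?thesis
    unfolding orbit_core_def
    using homeomorphic_map_interior_of[OF h closure_of_subset_topspace, of "small_orbit n y"]
      homeomorphic_map_closure_of[OF h small_orbit_topspace[OF y], of n]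
      act_small_orbit[OF v y] by simp
qed

lemma small_orbit_meets:
  assumes "openin X U" "U \<inter> X closure_of small_orbit n y \<noteq> {}"
  obtains v where "v \<in> fixing n" "\<phi> v y \<in> U"
  using openin_Int_closure_of_eq_empty[OF assms(1), of "small_orbit n y"] assms(2)
  by (auto simp: small_orbit_def)

text \<open>Elements of the subgroup permute the orbit whose closure defines a core, so each core is
  a union of orbits of that subgroup.\<close>

lemma mem_orbit_core_translate:
  assumes v: "v \<in> fixing n" and y: "y \<in> topspace X" and "\<phi> v y \<in> orbit_core n z" "z \<in> topspace X"
  shows "y \<in> orbit_core n z"
  using act_orbit_core[OF inv_fixing[OF v], of z] act_inv_act[OF fixing_G[OF v] y] assms
  by (metis imageI)

lemma self_orbit_core:
  assumes y: "y \<in> topspace X" and "orbit_core n y \<noteq> {}"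
  shows "y \<in> orbit_core n y"
proof -
  have "orbit_core n y \<inter> X closure_of small_orbit n y \<noteq> {}"
    using orbit_core_subset assms(2) by blast
  then obtain v where "v \<in> fixing n" "\<phi> v y \<in> orbit_core n y"
    using small_orbit_meets[OF openin_orbit_core] by blast
  then show ?thesis using mem_orbit_core_translate y by blast
qed

text \<open>If the cores of \<open>y\<close> and \<open>z\<close> meet, then the orbit of \<open>y\<close>, being dense in its core, enters
  the core of \<open>z\<close>, and by invariance it stays there.\<close>

lemma orbit_core_subset_if_meets:
  assumes y: "y \<in> topspace X" and z: "z \<in> topspace X"
    and meets: "orbit_core n y \<inter> orbit_core n z \<noteq> {}"
  shows "orbit_core n y \<subseteq> orbit_core n z"
proof -
  have "orbit_core n z \<inter> X closure_of small_orbit n y \<noteq> {}"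
    using meets orbit_core_subset by blast
  then obtain v where v: "v \<in> fixing n" "\<phi> v y \<in> orbit_core n z"
    using small_orbit_meets[OF openin_orbit_core] by blast
  then have "y \<in> orbit_core n z" using mem_orbit_core_translate y z by blast
  then have "small_orbit n y \<subseteq> orbit_core n z"
    using act_orbit_core[OF _ z] by (fastforce simp: small_orbit_def)
  then have "X closure_of small_orbit n y \<subseteq> X closure_of small_orbit n z"
    by (meson closure_of_minimal closedin_closure_of orbit_core_subset subset_trans)
  then show ?thesis
    unfolding orbit_core_def by (rule interior_of_mono)
qed

lemma orbit_core_eq_if_meets:
  assumes "y \<in> topspace X" "z \<in> topspace X" "orbit_core n y \<inter> orbit_core n z \<noteq> {}"
  shows "orbit_core n y = orbit_core n z"
  using orbit_core_subset_if_meets assms by (simp add: inf_commute subset_antisym)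

text \<open>Products of elements of a subgroup remain in it, so many steps reach no more than one.\<close>

lemma local_orbit_fixing_subset:
  assumes y: "y \<in> topspace X"
  shows "local_orbit \<phi> y U (fixing n) \<subseteq> small_orbit n y"
proof
  fix w assume "w \<in> local_orbit \<phi> y U (fixing n)"
  then obtain k g s where g: "\<And>i. i \<le> k \<Longrightarrow> g i \<in> fixing n" and s0: "s 0 = y"
    and s: "\<And>i. i \<le> k \<Longrightarrow> s (Suc i) = \<phi> (g i) (s i)" and w: "s (Suc k) = w"
    unfolding local_orbit_def by blast
  have "s i \<in> small_orbit n y" if "i \<le> Suc k" for i
    using that
  proof (induction i)
    case 0
    show ?case using s0 self_small_orbit y by simp
  next
    case (Suc i)
    then show ?case using s[of i] g[of i] act_small_orbit[OF _ y, of "g i" n] by auto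
  qed
  then show "w \<in> small_orbit n y" using w by auto
qed

lemma small_orbit_Int_subset_local_orbit:
  assumes "fixing n \<subseteq> V" "y \<in> U"
  shows "U \<inter> small_orbit n y \<subseteq> local_orbit \<phi> y U V"
proof
  fix w assume "w \<in> U \<inter> small_orbit n y"
  then obtain v where v: "v \<in> V" "w = \<phi> v y" "w \<in> U" using assms by (auto simp: small_orbit_def)
  show "w \<in> local_orbit \<phi> y U V"
    unfolding local_orbit_def mem_Collect_eq
    using v assms(2)
    by (intro conjI exI[of _ 0] exI[of _ "\<lambda>_. v"] exI[of _ "\<lambda>i. if i = 0 then y else w"]) auto
qed

text \<open>From left to right, take for \<open>U\<close> the whole space. From right to left, \<open>V\<close> contains some
  \<open>fixing n\<close>, and single steps from \<open>y\<close> already fill a dense part of the nonempty open set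
  \<open>U \<inter> orbit_core n y\<close>.\<close>

lemma turbulent_point_iff:
  assumes y: "y \<in> topspace X"
  shows "turbulent_point \<G> T X \<phi> y \<longleftrightarrow> locally_dense_orbits y"
proof
  assume turb: "turbulent_point \<G> T X \<phi> y"
  show "locally_dense_orbits y"
    unfolding locally_dense_orbits_def
  proof
    fix n
    have "X interior_of (X closure_of local_orbit \<phi> y (topspace X) (fixing n)) \<noteq> {}"
      using turb y symmetric_nbhd_fixing unfolding turbulent_point_def by blast
    moreover have "X interior_of (X closure_of local_orbit \<phi> y (topspace X) (fixing n)) \<subseteq> orbit_core n y"
      unfolding orbit_core_def
      by (intro interior_of_mono closure_of_mono local_orbit_fixing_subset y)
    ultimately show "y \<in> orbit_core n y" using self_orbit_core[OF y] by blast
  qed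
next
  assume dense: "locally_dense_orbits y"
  show "turbulent_point \<G> T X \<phi> y"
    unfolding turbulent_point_def
  proof (intro allI impI)
    fix U V assume UV: "openin X U \<and> y \<in> U \<and> symmetric_nbhd_one \<G> T V"
    then have "openin T V" "id \<in> V" by (auto simp: symmetric_nbhd_one_def one_S_infty)
    then obtain n where n: "fixing n \<subseteq> V" using fixing_neighbourhood_base by blast
    have "U \<inter> orbit_core n y \<subseteq> X closure_of (U \<inter> small_orbit n y)"
      using openin_Int_closure_of_subset UV orbit_core_subset by fast
    also have "\<dots> \<subseteq> X closure_of local_orbit \<phi> y U V"
      using small_orbit_Int_subset_local_orbit[OF n] UV by (intro closure_of_mono) auto
    finally have "U \<inter> orbit_core n y \<subseteq> X interior_of (X closure_of local_orbit \<phi> y U V)"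
      using UV by (intro interior_of_maximal) auto
    moreover have "y \<in> U \<inter> orbit_core n y" using UV dense by (simp add: locally_dense_orbits_def)
    ultimately show "X interior_of (X closure_of local_orbit \<phi> y U V) \<noteq> {}" by blast
  qed
qed

text \<open>Conjugation by \<open>g\<close> maps \<open>fixing m\<close> into \<open>fixing n\<close> for large \<open>m\<close>, so the homeomorphism
  \<open>\<phi> g\<close> carries a core of \<open>y\<close> into the given core of its image.\<close>

lemma locally_dense_orbits_act:
  assumes g: "g \<in> G" and y: "y \<in> topspace X" and dense: "locally_dense_orbits y"
  shows "locally_dense_orbits (\<phi> g y)"
  unfolding locally_dense_orbits_def
proof
  fix n
  let ?g' = "inv_into UNIV g"
  have h: "homeomorphic_map X X (\<phi> g)" using homeomorphic_map_act g by blast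
  obtain m where m: "\<And>i. i < n \<Longrightarrow> ?g' i < m" using finite_initial_segment_bound by metis
  have "\<phi> g ` small_orbit m y \<subseteq> small_orbit n (\<phi> g y)"
  proof
    fix w assume "w \<in> \<phi> g ` small_orbit m y"
    then obtain v where v: "v \<in> fixing m" and w: "w = \<phi> g (\<phi> v y)"
      by (auto simp: small_orbit_def)
    have vG: "v \<in> G" using v fixing_G by blast
    have "g (v (?g' i)) = i" if "i < n" for i
      using m[OF that] v bij_is_surj[OF bij_G[OF g]] by (simp add: fixing_def surj_f_inv_f)
    then have c: "g \<circ> v \<circ> ?g' \<in> fixing n"
      using comp_G inv_G g vG by (simp add: fixing_def)
    have "\<phi> (g \<circ> v \<circ> ?g') (\<phi> g y) = w"
      using act_comp comp_G inv_G g vG act_closed y act_inv_act w by simp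
    then show "w \<in> small_orbit n (\<phi> g y)" using c by (auto simp: small_orbit_def)
  qed
  then have "X closure_of (\<phi> g ` small_orbit m y) \<subseteq> X closure_of small_orbit n (\<phi> g y)"
    by (rule closure_of_mono)
  then have "\<phi> g ` (X closure_of small_orbit m y) \<subseteq> X closure_of small_orbit n (\<phi> g y)"
    using homeomorphic_map_closure_of[OF h small_orbit_topspace[OF y]] by simp
  then have "\<phi> g ` orbit_core m y \<subseteq> orbit_core n (\<phi> g y)"
    unfolding orbit_core_def
    by (metis h closure_of_subset_topspace homeomorphic_map_interior_of interior_of_mono)
  then show "\<phi> g y \<in> orbit_core n (\<phi> g y)"
    using dense by (auto simp: locally_dense_orbits_def)
qed

section \<open>A dense G-delta orbit is turbulent\<close>

text \<open>The subgroup \<open>fixing n\<close> has countable index: a left coset is determined by the values of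
  its members on \<open>0, \<dots>, n - 1\<close>, and there are only countably many lists of naturals.\<close>

lemma countable_translates:
  assumes y: "y \<in> topspace X"
  obtains K where "countable K" "K \<subseteq> G" "orbit \<G> \<phi> y = (\<Union>g\<in>K. \<phi> g ` small_orbit n y)"
proof -
  define r where "r = (\<lambda>g::nat \<Rightarrow> nat. map g [0..<n])"
  \<comment> \<open>one representative for each coset\<close>
  define K where "K = inv_into G r ` r ` G"
  have "countable K" unfolding K_def by simp
  moreover have KG: "K \<subseteq> G" unfolding K_def by (auto intro: inv_into_into)
  moreover have "orbit \<G> \<phi> y \<subseteq> (\<Union>g\<in>K. \<phi> g ` small_orbit n y)"
  proof
    fix w assume "w \<in> orbit \<G> \<phi> y"
    then obtain h where h: "h \<in> G" and w: "w = \<phi> h y" by (auto simp: orbit_def)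
    define g where "g = inv_into G r (r h)"
    have gK: "g \<in> K" and gG: "g \<in> G" using h KG unfolding K_def g_def by auto
    have "r g = r h" unfolding g_def using h by (simp add: f_inv_into_f)
    then have "g i = h i" if "i < n" for i using that by (simp add: r_def)
    then have "inv_into UNIV g \<circ> h \<in> fixing n"
      using inv_f_f[OF bij_is_inj[OF bij_G[OF gG]]] comp_G[OF inv_G[OF gG] h]
      by (auto simp: fixing_def) (metis)
    moreover have "\<phi> g (\<phi> (inv_into UNIV g \<circ> h) y) = w"
      using act_comp[OF inv_G[OF gG] h y] act_act_inv[OF gG] act_closed h y w by simp
    ultimately have "w \<in> \<phi> g ` small_orbit n y" by (auto simp: small_orbit_def)
    then show "w \<in> (\<Union>g\<in>K. \<phi> g ` small_orbit n y)" using gK by blast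
  qed
  moreover have "(\<Union>g\<in>K. \<phi> g ` small_orbit n y) \<subseteq> orbit \<G> \<phi> y"
  proof clarsimp
    fix g z assume "g \<in> K" "z \<in> small_orbit n y"
    then obtain v where "v \<in> fixing n" "z = \<phi> v y" "g \<in> G" using KG by (auto simp: small_orbit_def)
    then have "\<phi> g z = \<phi> (g \<circ> v) y" "g \<circ> v \<in> G"
      using act_comp comp_G fixing_G y by auto
    then show "\<phi> g z \<in> orbit \<G> \<phi> y" by (auto simp: orbit_def)
  qed
  ultimately show thesis using that by blast
qed

text \<open>If \<open>small_orbit n y\<close> were nowhere dense, the complements of the closures of its countably
  many translates, together with the open sets whose intersection is the orbit, would be
  countably many dense open sets with empty intersection.\<close>

lemma dense_gdelta_orbit_locally_dense:
  assumes cm: "completely_metrizable_space X" and y: "y \<in> topspace X"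
    and dense: "dense_in X (orbit \<G> \<phi> y)" and gdelta: "gdelta_in X (orbit \<G> \<phi> y)"
  shows "locally_dense_orbits y"
  unfolding locally_dense_orbits_def
proof (rule allI, rule ccontr)
  fix n assume "y \<notin> orbit_core n y"
  then have empty: "X interior_of (X closure_of small_orbit n y) = {}"
    using self_orbit_core[OF y] unfolding orbit_core_def by blast
  obtain K where K: "countable K" "K \<subseteq> G" and orb: "orbit \<G> \<phi> y = (\<Union>g\<in>K. \<phi> g ` small_orbit n y)"
    using countable_translates[OF y] .
  obtain C :: "nat \<Rightarrow> 'a set" where C: "\<And>k. openin X (C k)" "\<Inter>(range C) = orbit \<G> \<phi> y"
    using gdelta unfolding gdelta_in_descending by blast
  define N where "N = (\<lambda>g. topspace X - X closure_of (\<phi> g ` small_orbit n y))"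
  have "X closure_of \<Inter>(range C \<union> N ` K) = topspace X"
  proof (rule Baire_category)
    show "countable (range C \<union> N ` K)" using K by simp
    fix S assume "S \<in> range C \<union> N ` K"
    then show "openin X S \<and> X closure_of S = topspace X"
    proof
      assume "S \<in> range C"
      then have "orbit \<G> \<phi> y \<subseteq> S" "openin X S" using C by auto
      then show ?thesis
        using dense closure_of_mono[of "orbit \<G> \<phi> y" S X] closure_of_subset_topspace[of X S]
        unfolding dense_in_def by auto
    next
      assume "S \<in> N ` K"
      then obtain g where g: "g \<in> G" and S: "S = N g" using K by auto
      have h: "homeomorphic_map X X (\<phi> g)" using homeomorphic_map_act g by blast
      have "X interior_of (X closure_of (\<phi> g ` small_orbit n y)) = {}"
        using homeomorphic_map_interior_of[OF h closure_of_subset_topspace, of "small_orbit n y"]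
          homeomorphic_map_closure_of[OF h small_orbit_topspace[OF y], of n] empty by simp
      then show ?thesis
        unfolding S N_def by (auto simp: closure_of_complement)
    qed
  qed (use cm in simp)
  moreover have "\<Inter>(range C \<union> N ` K) = {}"
  proof -
    have "w \<notin> \<Inter>(N ` K)" if w: "w \<in> orbit \<G> \<phi> y" for w
    proof -
      obtain g where g: "g \<in> K" "w \<in> \<phi> g ` small_orbit n y" using w orb by blast
      moreover have "\<phi> g ` small_orbit n y \<subseteq> topspace X"
        using g K small_orbit_topspace[OF y] act_closed by blast
      ultimately have "w \<notin> N g" unfolding N_def using closure_of_subset by fastforce
      then show ?thesis using g by blast
    qed
    then have "orbit \<G> \<phi> y \<inter> \<Inter>(N ` K) = {}" by (meson disjoint_iff)
    then show ?thesis by (simp only: Inter_Un_distrib C(2))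
  qed
  ultimately show False using y by simp
qed


section \<open>A dense turbulent orbit is G-delta\<close>

text \<open>The increment from \<open>a n\<close> to \<open>a (Suc n)\<close> fixes the values of \<open>a n\<close> at arguments below \<open>n\<close>, so the images
  of each point stabilise, and it fixes all numbers below \<open>n\<close>, so the preimages stabilise too.
  The second part makes the limit surjective: pointwise limits of permutations need not be.\<close>

lemma convergent_if_increments_fixing:
  assumes closed: "closedin S_infty_top G" and aG: "\<And>n. a n \<in> G"
    and step: "\<And>n. \<exists>v\<in>fixing (k n). a (Suc n) = v \<circ> a n"
    and k: "\<And>n. n \<le> k n" and ak: "\<And>n i. i < n \<Longrightarrow> a n i < k n"
  obtains g where "g \<in> G" "limitin T a g sequentially"
proof -
  have stable: "a m i = a n i" if "i < n" "n \<le> m" for i n m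
    using that(2)
  proof (induction m rule: dec_induct)
    case (step m)
    obtain v where "v \<in> fixing (k m)" "a (Suc m) = v \<circ> a m"
      using assms(3) by blast
    then show ?case using step ak[of i m] \<open>i < n\<close> by (auto simp: fixing_def)
  qed simp
  have hit: "a m i = a n i" if "a n i < n" "n \<le> m" for i n m
    using that(2)
  proof (induction m rule: dec_induct)
    case (step m)
    obtain v where "v \<in> fixing (k m)" "a (Suc m) = v \<circ> a m"
      using assms(3) by blast
    then show ?case using step k[of m] \<open>a n i < n\<close> by (auto simp: fixing_def)
  qed simp
  define g where "g = (\<lambda>i. a (Suc i) i)"
  have ev: "a m i = g i" if "i < m" for i m
    using stable[of i "Suc i" m] that unfolding g_def by simp
  have "inj g"
  proof (rule injI)
    fix i j assume "g i = g j"
    then have "a (Suc (max i j)) i = a (Suc (max i j)) j" using ev by simp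
    then show "i = j" using bij_is_inj[OF bij_G[OF aG]] by (simp add: inj_eq)
  qed
  moreover have "surj g"
  proof (rule surjI)
    fix j
    define i where "i = inv_into UNIV (a (Suc j)) j"
    have i: "a (Suc j) i = j"
      unfolding i_def using bij_is_surj[OF bij_G[OF aG]] by (rule surj_f_inv_f)
    have "a (Suc (max i j)) i = j" using hit[of "Suc j" i "Suc (max i j)"] i by simp
    then show "g (inv_into UNIV (a (Suc j)) j) = j" using ev[of i "Suc (max i j)"] i_def by simp
  qed
  ultimately have "g \<in> carrier S_infty" by (simp add: S_infty_carrier bij_def)
  moreover have "limitin (product_topology (\<lambda>_::nat. discrete_topology (UNIV :: nat set)) UNIV) a g sequentially"
    unfolding limitin_componentwise
  proof (intro conjI ballI)
    fix i
    have "eventually (\<lambda>m. a m i = g i) sequentially"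
      using ev unfolding eventually_sequentially by (metis Suc_le_eq)
    then show "limitin (discrete_topology UNIV) (\<lambda>m. a m i) (g i) sequentially"
      unfolding limitin_def by (auto elim: eventually_mono)
  qed auto
  ultimately have lim: "limitin S_infty_top a g sequentially"
    unfolding S_infty_top_def limitin_subtopology using aG G_subset by (auto simp: subset_iff)
  then have "g \<in> G" by (rule limitin_closedin) (use closed aG in auto)
  then show thesis using that lim aG by (simp add: limitin_subtopology)
qed

lemma limitin_act:
  assumes "limitin T a g sequentially" "y \<in> topspace X"
  shows "limitin X (\<lambda>n. \<phi> (a n) y) (\<phi> g y) sequentially"
proof -
  have "limitin (prod_topology T X) (\<lambda>n. (a n, y)) (g, y) sequentially"
    using assms by (simp add: limitin_pairwise o_def)
  from continuous_map_limit[OF continuous_map_action this] show ?thesis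
    by (simp add: o_def)
qed

text \<open>The points \<open>x\<close> and \<open>z\<close> are moved alternately. At stage \<open>n\<close> the state \<open>(a, b, k)\<close> records
  the translate \<open>a\<close> of the point about to be moved, the translate \<open>b\<close> of the other one, and the
  length \<open>k\<close> of the initial segment that the next increment has to fix. The invariant says
  that the other translate lies in the \<open>k\<close>-th core of the one to be moved, so an increment in
  \<open>fixing k\<close> brings the two as close together as desired. The new position is chosen within
  the next core of the other translate, which restores the invariant with the roles exchanged.\<close>

lemma same_orbit_back_and_forth:
  assumes closed: "closedin S_infty_top G" and cm: "completely_metrizable_space X"
    and x: "x \<in> topspace X" "locally_dense_orbits x"
    and z: "z \<in> topspace X" "locally_dense_orbits z"
    and zx: "z \<in> orbit_core 0 x"
  shows "z \<in> orbit \<G> \<phi> x"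
proof -
  obtain M d where md: "Metric_space M d" and complete: "Metric_space.mcomplete M d"
    and X: "X = Metric_space.mtopology M d"
    using cm by (auto simp: completely_metrizable_space_def)
  interpret Metric_space M d by (fact md)
  define c where "c = (\<lambda>n::nat. if even n then x else z)"
  have c: "c n \<in> topspace X" "locally_dense_orbits (c n)" for n
    using x z by (auto simp: c_def)
  have c2: "c (Suc (Suc n)) = c n" for n by (simp add: c_def)
  define P where "P = (\<lambda>n (a, b, k). a \<in> G \<and> b \<in> G \<and> n \<le> k \<and> (\<forall>i<n. a i < k) \<and>
    \<phi> b (c (Suc n)) \<in> orbit_core k (\<phi> a (c n)))"
  define Q where "Q = (\<lambda>n (a, b, k) (a', b', k'::nat). a' = b \<and> (\<exists>v\<in>fixing k. b' = v \<circ> a) \<and>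
    d (\<phi> b (c (Suc n))) (\<phi> b' (c n)) \<le> (1/2) ^ n)"
  have "P 0 (id, id, 0)"
    using zx x z by (simp add: P_def c_def id_G act_id)
  moreover have "\<exists>s'. P (Suc n) s' \<and> Q n s s'" if "P n s" for n s
  proof -
    obtain a b k where s: "s = (a, b, k)" by (cases s)
    with that have a: "a \<in> G" and b: "b \<in> G"
      and q: "\<phi> b (c (Suc n)) \<in> orbit_core k (\<phi> a (c n))" by (auto simp: P_def)
    define q where "q = \<phi> b (c (Suc n))"
    have qX: "q \<in> topspace X" "locally_dense_orbits q"
      unfolding q_def using act_closed locally_dense_orbits_act b c by blast+
    obtain m where m: "\<And>i. i < Suc n \<Longrightarrow> b i < m" using finite_initial_segment_bound by metis
    \<comment> \<open>The next move is applied after \<open>b\<close>, so \<open>k'\<close> must exceed the values of \<open>b\<close> to be kept.\<close>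
    define k' where "k' = max m (Suc n)"
    define O' where "O' = orbit_core k' q \<inter> orbit_core k (\<phi> a (c n)) \<inter> mball q ((1/2) ^ n)"
    have "q \<in> O'"
      using qX q unfolding O'_def locally_dense_orbits_def q_def by (auto simp: X)
    then have "O' \<inter> X closure_of small_orbit k (\<phi> a (c n)) \<noteq> {}"
      using orbit_core_subset unfolding O'_def by blast
    moreover have "openin X O'"
      unfolding O'_def by (intro openin_Int openin_orbit_core) (simp add: X)
    ultimately obtain v where v: "v \<in> fixing k" "\<phi> v (\<phi> a (c n)) \<in> O'"
      using small_orbit_meets by blast
    have "\<phi> (v \<circ> a) (c n) \<in> O'" using v act_comp fixing_G a c by simp
    then have "P (Suc n) (b, v \<circ> a, k')" "Q n s (b, v \<circ> a, k')"
      using b comp_G[OF fixing_G[OF v(1)] a] m v(1) c2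
      by (auto simp: P_def Q_def s O'_def q_def k'_def less_max_iff_disj)
    then show ?thesis by blast
  qed
  ultimately obtain f where f: "\<And>n. P n (f n)" "\<And>n. Q n (f n) (f (Suc n))"
    using dependent_nat_choice[of P Q] by blast
  define A where "A = (\<lambda>n. fst (f n))"
  define K where "K = (\<lambda>n. snd (snd (f n)))"
  have fA: "f n = (A n, A (Suc n), K n)" for n
    using f(2)[of n] unfolding A_def K_def Q_def by (cases "f n", cases "f (Suc n)") auto
  have AG: "A n \<in> G" and nK: "n \<le> K n" and AK: "i < n \<Longrightarrow> A n i < K n" for n i
    using f(1)[of n] unfolding fA P_def by auto
  have step: "\<exists>v\<in>fixing (K n). A (Suc (Suc n)) = v \<circ> A n" for n
    using f(2)[of n] unfolding fA Q_def by auto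
  define \<sigma> where "\<sigma> = (\<lambda>n. \<phi> (A n) (c n))"
  have "d (\<sigma> (Suc n)) (\<sigma> (Suc (Suc n))) \<le> (1/2) ^ n" for n
    using f(2)[of n] c2 unfolding fA Q_def \<sigma>_def by auto
  moreover have "\<sigma> n \<in> M" for n
    unfolding \<sigma>_def using act_closed AG c X by simp
  ultimately have "MCauchy (\<lambda>n. \<sigma> (Suc n))"
    by (intro MCauchy_geometric)
  then obtain p where "limitin X (\<lambda>n. \<sigma> (Suc n)) p sequentially"
    using complete unfolding mcomplete_def X by blast
  then have p: "limitin X \<sigma> p sequentially"
    using limitin_sequentially_offset_rev[of X \<sigma> 1 p] by simp
  have sub: "limitin X (\<lambda>n. \<sigma> (r n)) p sequentially" if "strict_mono r" for r
    using limitin_subsequence[OF that p] by (simp add: o_def)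
  have haus: "Hausdorff_space X" unfolding X by (rule Hausdorff_space_mtopology)
  have mono: "strict_mono (\<lambda>n::nat. 2 * n)" "strict_mono (\<lambda>n::nat. Suc (2 * n))"
    by (auto simp: strict_mono_def)
  obtain g where g: "g \<in> G" "limitin T (\<lambda>n. A (2 * n)) g sequentially"
    by (rule convergent_if_increments_fixing[OF closed, of "\<lambda>n. A (2 * n)" "\<lambda>n. K (2 * n)"])
      (use AG AK step in \<open>auto intro: order_trans[OF _ nK]\<close>)
  obtain h where h: "h \<in> G" "limitin T (\<lambda>n. A (Suc (2 * n))) h sequentially"
    by (rule convergent_if_increments_fixing[OF closed, of "\<lambda>n. A (Suc (2 * n))" "\<lambda>n. K (Suc (2 * n))"])
      (use AG AK step in \<open>auto intro: order_trans[OF _ nK]\<close>)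
  have "\<phi> g x = p"
    using limitin_act[OF g(2) x(1)] sub[OF mono(1)] haus
    by (intro limitin_Hausdorff_unique[of X "\<lambda>n. \<phi> (A (2 * n)) x" _ sequentially]) (auto simp: \<sigma>_def c_def)
  moreover have "\<phi> h z = p"
    using limitin_act[OF h(2) z(1)] sub[OF mono(2)] haus
    by (intro limitin_Hausdorff_unique[of X "\<lambda>n. \<phi> (A (Suc (2 * n))) z" _ sequentially]) (auto simp: \<sigma>_def c_def)
  ultimately have "z = \<phi> (inv_into UNIV h \<circ> g) x"
    using act_inv_act[OF h(1) z(1)] act_comp[OF inv_G[OF h(1)] g(1) x(1)] by simp
  then show ?thesis using comp_G[OF inv_G[OF h(1)] g(1)] by (auto simp: orbit_def)
qed

text \<open>With a countable base, density of \<open>small_orbit n w\<close> in the core containing \<open>w\<close> is tested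
  on basic open sets \<open>B\<close>; for each \<open>n\<close> and \<open>B\<close> the test is an open condition \<open>W (n, B)\<close>.
  The witness \<open>y\<close> in \<open>W (n, B)\<close> may vary with \<open>B\<close>, but all cores containing the same point
  coincide. Density of the orbit makes the core of index \<open>0\<close> the whole space, which gives the
  back-and-forth construction its starting position.\<close>

lemma locally_dense_orbit_gdelta:
  assumes closed: "closedin S_infty_top G" and Polish: "Polish_space X"
    and x: "x \<in> topspace X" and dense: "dense_in X (orbit \<G> \<phi> x)"
    and ld: "locally_dense_orbits x"
  shows "gdelta_in X (orbit \<G> \<phi> x)"
proof -
  have cm: "completely_metrizable_space X" using Polish by (simp add: Polish_space_def)
  have "second_countable X"
    using Polish separable_metrizable_imp_second_countable completely_metrizable_imp_metrizable_space
    by (auto simp: Polish_space_def)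
  then obtain \<B> where \<B>: "countable \<B>" "\<And>B. B \<in> \<B> \<Longrightarrow> openin X B"
    and base: "\<And>U w. openin X U \<Longrightarrow> w \<in> U \<Longrightarrow> \<exists>B\<in>\<B>. w \<in> B \<and> B \<subseteq> U"
    unfolding second_countable_def by metis
  let ?O = "orbit \<G> \<phi> x"
  have O: "y \<in> topspace X" "locally_dense_orbits y" if "y \<in> ?O" for y
    using that act_closed locally_dense_orbits_act x ld by (auto simp: orbit_def)
  define W where "W = (\<lambda>(n, B). \<Union>y\<in>?O.
    {w \<in> orbit_core n y. B \<inter> orbit_core n y = {} \<or> small_orbit n w \<inter> B \<noteq> {}})"
  have openW: "openin X (W (n, B))" if B: "B \<in> \<B>" for n B
    unfolding W_def prod.case
  proof (rule openin_clauses(3), clarify)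
    fix y assume y: "y \<in> ?O"
    show "openin X {w \<in> orbit_core n y. B \<inter> orbit_core n y = {} \<or> small_orbit n w \<inter> B \<noteq> {}}"
    proof (cases "B \<inter> orbit_core n y = {}")
      case False
      have "openin X (\<Union>v\<in>fixing n. {w \<in> topspace X. \<phi> v w \<in> B})"
        using openin_continuous_map_preimage[OF continuous_map_act[OF fixing_G] \<B>(2)[OF B]] by blast
      moreover have "{w \<in> orbit_core n y. B \<inter> orbit_core n y = {} \<or> small_orbit n w \<inter> B \<noteq> {}}
          = orbit_core n y \<inter> (\<Union>v\<in>fixing n. {w \<in> topspace X. \<phi> v w \<in> B})"
        using False openin_subset[OF openin_orbit_core[of n y]] by (auto simp: small_orbit_def)
      ultimately show ?thesis by (simp add: openin_Int)
    qed simp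
  qed
  have "?O \<subseteq> W (n, B)" if B: "B \<in> \<B>" for n B
  proof
    fix y assume y: "y \<in> ?O"
    have "small_orbit n y \<inter> B \<noteq> {}" if "B \<inter> orbit_core n y \<noteq> {}"
    proof -
      have "B \<inter> X closure_of small_orbit n y \<noteq> {}" using that orbit_core_subset by blast
      then show ?thesis using openin_Int_closure_of_eq_empty[OF \<B>(2)[OF B]] by blast
    qed
    moreover have "y \<in> orbit_core n y" using O[OF y] by (simp add: locally_dense_orbits_def)
    ultimately show "y \<in> W (n, B)" using y unfolding W_def by blast
  qed
  moreover have "z \<in> ?O" if z: "\<And>n B. B \<in> \<B> \<Longrightarrow> z \<in> W (n, B)" for z
  proof -
    obtain B0 where B0: "B0 \<in> \<B>" using base[OF openin_topspace x] by blast
    have zX: "z \<in> topspace X" using openin_subset[OF openW[OF B0]] z[OF B0] by blast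
    have "z \<in> orbit_core n z" for n
    proof -
      obtain y where y: "y \<in> ?O" "z \<in> orbit_core n y" using z[OF B0, of n] by (auto simp: W_def)
      have "orbit_core n y \<subseteq> X closure_of small_orbit n z"
      proof
        fix w assume w: "w \<in> orbit_core n y"
        have "small_orbit n z \<inter> U \<noteq> {}" if U: "openin X U" "w \<in> U" for U
        proof -
          obtain B where B: "B \<in> \<B>" "w \<in> B" "B \<subseteq> U" using base[OF U] by blast
          obtain y' where y': "y' \<in> ?O" "z \<in> orbit_core n y'"
            "B \<inter> orbit_core n y' = {} \<or> small_orbit n z \<inter> B \<noteq> {}"
            using z[OF B(1), of n] by (auto simp: W_def)
          have "orbit_core n y' = orbit_core n y"
            using orbit_core_eq_if_meets O(1) y y' by blast
          then show ?thesis using y'(3) w B by blast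
        qed
        then show "w \<in> X closure_of small_orbit n z"
          using w openin_subset[OF openin_orbit_core[of n y]] unfolding in_closure_of by blast
      qed
      then have "orbit_core n y \<subseteq> orbit_core n z"
        unfolding orbit_core_def[of n z] by (simp add: interior_of_maximal)
      then show ?thesis using y(2) by blast
    qed
    then have "locally_dense_orbits z" by (simp add: locally_dense_orbits_def)
    moreover have "orbit_core 0 x = topspace X"
      using dense by (simp add: orbit_core_def small_orbit_0 dense_in_def interior_of_topspace)
    ultimately show ?thesis
      using same_orbit_back_and_forth[OF closed cm x ld zX] zX by simp
  qed
  ultimately have "?O = \<Inter>(W ` (UNIV \<times> \<B>))" by auto
  moreover have "gdelta_in X (\<Inter>(W ` (UNIV \<times> \<B>)))"
  proof (rule gdelta_in_Inter)
    show "countable (W ` (UNIV \<times> \<B>))" using \<B>(1) by simp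
    show "W ` (UNIV \<times> \<B>) \<noteq> {}" using base[OF openin_topspace x] by auto
  qed (use openW in \<open>auto intro: open_imp_gdelta_in\<close>)
  ultimately show ?thesis by simp
qed

lemma turbulent_orbit_iff:
  assumes x: "x \<in> topspace X"
  shows "turbulent_orbit \<G> T X \<phi> (orbit \<G> \<phi> x) \<longleftrightarrow> locally_dense_orbits x"
proof -
  have orb: "orbit \<G> \<phi> x = (\<lambda>g. \<phi> g x) ` G" by (auto simp: orbit_def)
  have "locally_dense_orbits x" if "\<forall>g\<in>G. locally_dense_orbits (\<phi> g x)"
    using that id_G act_id[OF x] by metis
  then show ?thesis
    unfolding turbulent_orbit_def orb ball_simps
    using turbulent_point_iff[OF act_closed[OF _ x]] locally_dense_orbits_act[OF _ x] by metis
qed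

end

theorem proposition1p4:
  fixes G :: "(nat \<Rightarrow> nat) set" and X :: "'a topology"
    and \<phi> :: "(nat \<Rightarrow> nat) \<Rightarrow> 'a \<Rightarrow> 'a" and x :: 'a
  defines "\<G> \<equiv> S_infty\<lparr>carrier := G\<rparr>"
    and "T \<equiv> subtopology S_infty_top G"
  assumes "subgroup G S_infty" and "closedin S_infty_top G"
    and "Polish_space X"
    and "continuous_action \<G> T X \<phi>"
    and "x \<in> topspace X"
  shows "dense_in X (orbit \<G> \<phi> x) \<and> gdelta_in X (orbit \<G> \<phi> x) \<longleftrightarrow>
         dense_in X (orbit \<G> \<phi> x) \<and> turbulent_orbit \<G> T X \<phi> (orbit \<G> \<phi> x)"
proof -
  have "permutation_group_action G X \<phi>"
    using assms(3,6) unfolding \<G>_def T_def by (rule permutation_group_action.intro)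
  then interpret permutation_group_action G X \<phi> .
  have cm: "completely_metrizable_space X"
    using assms(5) by (simp add: Polish_space_def)
  show ?thesis
    unfolding \<G>_def T_def turbulent_orbit_iff[OF assms(7)]
    using dense_gdelta_orbit_locally_dense[OF cm assms(7)]
      locally_dense_orbit_gdelta[OF assms(4,5,7)] by iprover
qed

end
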